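(* Let $\mathcal{P}=\{x\in\mathbb{R}^n : Ax=b,\ x(i)\ge 0\ \forall i\in\mathcal{I}\}$ be a 2-level polytope with vertex set $\mathcal{V}\ne\emptyset$, normalized so that $v(i)\in\{0,1\}$ for all $v\in\mathcal{V}$, $i\in\mathcal{I}$, and let $f:\mathbb{R}^n\to\mathbb{R}$ be convex, continuously differentiable and $\beta$-smooth. Suppose the Pairwise Decomposition-Invariant Conditional Gradient algorithm with dyadic step-sizes (described in the context) is initialized with $x_1\in\mathcal{V}$ such that $x_1\in\arg\min_{v\in\mathcal{V}}\langle v,\nabla f(x_0)\rangle$ for some arbitrary $x_0\in\mathcal{P}$. Let $x_1,x_2,\dots$ be its iterates, and write $h_t=f(x_t)-f^*$ and $g_t=\langle x_t-v_{t,+},\nabla f(x_t)\rangle$. (1) If the quadratic growth condition with parameter $\alpha>0$ holds, i.e. $\mathrm{dist}(x,\mathcal{X}^* )^2\le\frac{2}{\alpha}(f(x)-f^* )$ for all $x\in\mathcal{P}$, then $$\forall t\ge 1:\quad h_{t+1}\le\left(1-\frac{1}{16}\min\left\{1,\frac{\alpha}{(d^*+1)\beta D^2}\right\}\right)h_t .$$ (2) Moreover, even without assuming quadratic growth, $$\forall t\ge 1:\quad h_t\le\frac{8\beta D^2}{t+15},$$ $$\forall t\ge 3:\quad \min_{\tau\in\{1,\dots,t\}}g_\tau\le\frac{16\beta D^2}{t-1}\log(t-1).$$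
   Context: Problem: minimize $f$ over $\mathcal{P}$, where $\mathcal{P}\subset\mathbb{R}^n$ is a (nonempty, bounded) polytope of the form $\{x: Ax=b,\ x(i)\ge0\ \forall i\in\mathcal{I}\}$, $\mathcal{I}\subseteq[n]$. $\mathcal{V}$ is its set of vertices. $\|\cdot\|$ is the Euclidean norm, $D$ is the Euclidean diameter of $\mathcal{P}$, $\mathcal{X}^*$ is the set of minimizers of $f$ over $\mathcal{P}$, $f^*$ is the minimal value, and $\mathrm{dist}(x,S)=\min_{y\in S}\|x-y\|$. $f$ is $\beta$-smooth means $\nabla f$ is $\beta$-Lipschitz on $\mathbb{R}^n$ w.r.t. the Euclidean norm. $\mathcal{F}^*$ is the minimal face of $\mathcal{P}$ containing $\mathcal{X}^*$ and $d^*=\dim(\mathcal{F}^* )$. For $x\in\mathcal{P}$, $\mathcal{F}(x)=\{y\in\mathcal{P}: y(i)=0\text{ for all }i\in\mathcal{I}\text{ with }x(i)=0\}$ is the minimal face of $\mathcal{P}$ containing $x$. 2-level: for every $i\in\mathcal{I}$ there is $a_i>0$ such that $v(i)\in\{0,a_i\}$ for every vertex $v$; the paper assumes the scaling $a_i=1$. Algorithm. Input: a vertex $x_1\in\mathcal{V}$. Set $\eta\leftarrow1$. For $t=1,2,\dots$: - let $v_{t,+}\in\arg\min_{v\in\mathcal{V}}\langle v,\nabla f(x_t)\rangle$; - if $\langle x_t-v_{t,+},\nabla f(x_t)\rangle=0$, stop; - let $v_{t,-}\in\arg\max_{v\in\mathcal{V}\cap\mathcal{F}(x_t)}\langle v,\nabla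 f(x_t)\rangle$; - let $i$ be the smallest integer such that $2^{-i}\le\eta$ and $f(x_t+2^{-i}(v_{t,+}-v_{t,-}))<f(x_t)$; - set $\eta\leftarrow2^{-i}$, $\eta_t\leftarrow\eta/2$, and $x_{t+1}\leftarrow x_t+\eta_t(v_{t,+}-v_{t,-})$. Ties in $\arg\min$/$\arg\max$ are broken arbitrarily. The bounds are understood for all $t$ for which the quantities involved are generated by the algorithm (before or at stopping). *)

theory Defs
  imports "HOL-Analysis.Analysis"
begin

definition std_polyhedron :: "real^'n^'m \<Rightarrow> real^'m \<Rightarrow> 'n set \<Rightarrow> (real^'n) set" where
  "std_polyhedron A b I = {x. A *v x = b \<and> (\<forall>i\<in>I. 0 \<le> x $ i)}"

definition vertices :: "'a::real_vector set \<Rightarrow> 'a set" where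
  "vertices P = {v. v extreme_point_of P}"

definition two_level :: "(real^'n) set \<Rightarrow> 'n set \<Rightarrow> bool" where
  "two_level P I \<longleftrightarrow> (\<forall>i\<in>I. \<exists>a>0. \<forall>v\<in>vertices P. v $ i \<in> {0, a})"

definition min_face :: "(real^'n) set \<Rightarrow> 'n set \<Rightarrow> real^'n \<Rightarrow> (real^'n) set" where
  "min_face P I x = {y\<in>P. \<forall>i\<in>I. x $ i = 0 \<longrightarrow> y $ i = 0}"

definition opt_val :: "('a \<Rightarrow> real) \<Rightarrow> 'a set \<Rightarrow> real" where
  "opt_val f P = (INF x\<in>P. f x)"

definition opt_set :: "('a \<Rightarrow> real) \<Rightarrow> 'a set \<Rightarrow> 'a set" where
  "opt_set f P = {x. is_arg_min f (\<lambda>y. y \<in> P) x}"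

(* Arbitrary intersections of faces are faces, so this is the inclusion-minimal face of P
   containing the set of minimizers. *)
definition opt_face :: "('a::real_vector \<Rightarrow> real) \<Rightarrow> 'a set \<Rightarrow> 'a set" where
  "opt_face f P = \<Inter>{F. F face_of P \<and> opt_set f P \<subseteq> F}"

definition quadratic_growth :: "('a::metric_space \<Rightarrow> real) \<Rightarrow> 'a set \<Rightarrow> real \<Rightarrow> bool" where
  "quadratic_growth f P \<alpha> \<longleftrightarrow>
     (\<forall>x\<in>P. (infdist x (opt_set f P))\<^sup>2 \<le> 2 / \<alpha> * (f x - opt_val f P))"

definition fw_gap :: "('a::real_inner \<Rightarrow> 'a) \<Rightarrow> (nat \<Rightarrow> 'a) \<Rightarrow> (nat \<Rightarrow> 'a) \<Rightarrow> nat \<Rightarrow> real" where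
  "fw_gap grad x vp t = (x t - vp t) \<bullet> grad (x t)"

(* x t is generated iff no earlier iteration met the stopping condition. The values of the
   sequences at other indices are meaningless. *)
definition generated :: "('a::real_inner \<Rightarrow> 'a) \<Rightarrow> (nat \<Rightarrow> 'a) \<Rightarrow> (nat \<Rightarrow> 'a) \<Rightarrow> nat \<Rightarrow> bool" where
  "generated grad x vp t \<longleftrightarrow> 1 \<le> t \<and> (\<forall>s\<in>{1..<t}. fw_gap grad x vp s \<noteq> 0)"

definition dyadic_descent :: "('a::real_vector \<Rightarrow> real) \<Rightarrow> real \<Rightarrow> 'a \<Rightarrow> 'a \<Rightarrow> int \<Rightarrow> bool" where
  "dyadic_descent f \<eta> x d i \<longleftrightarrow>
     2 powi (- i) \<le> \<eta> \<and> f (x + (2 powi (- i)) *\<^sub>R d) < f x"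

(* \<eta> t is the value of the program variable at the start of iteration t, so the step taken in
   iteration t has length \<eta> (Suc t) / 2. Ties are resolved arbitrarily: vp and vm are any
   sequences of admissible choices. *)
definition pdicg_run ::
  "(real^'n \<Rightarrow> real) \<Rightarrow> (real^'n \<Rightarrow> real^'n) \<Rightarrow> (real^'n) set \<Rightarrow> 'n set \<Rightarrow>
   (nat \<Rightarrow> real^'n) \<Rightarrow> (nat \<Rightarrow> real^'n) \<Rightarrow> (nat \<Rightarrow> real^'n) \<Rightarrow> (nat \<Rightarrow> real) \<Rightarrow> bool" where
  "pdicg_run f grad P I x vp vm \<eta> \<longleftrightarrow>
     x 1 \<in> vertices P \<and> \<eta> 1 = 1 \<and>
     (\<forall>t. generated grad x vp t \<longrightarrow>
        is_arg_min (\<lambda>v. v \<bullet> grad (x t)) (\<lambda>v. v \<in> vertices P) (vp t) \<and>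
        (fw_gap grad x vp t \<noteq> 0 \<longrightarrow>
           is_arg_max (\<lambda>v. v \<bullet> grad (x t)) (\<lambda>v. v \<in> vertices P \<inter> min_face P I (x t)) (vm t) \<and>
           (\<exists>i. is_arg_min id (dyadic_descent f (\<eta> t) (x t) (vp t - vm t)) i \<and>
                \<eta> (Suc t) = 2 powi (- i)) \<and>
           x (Suc t) = x t + (\<eta> (Suc t) / 2) *\<^sub>R (vp t - vm t)))"

end

theory Submission
  imports Defs
begin

text \<open>Let \<open>L = \<beta> D\<^sup>2\<close> and let \<open>G\<^sub>t = \<langle>v\<^sub>t\<^sub>- - v\<^sub>t\<^sub>+, \<nabla>f(x\<^sub>t)\<rangle>\<close> be the pairwise gap, so that \<open>h\<^sub>t \<le> g\<^sub>t \<le> G\<^sub>t\<close>.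
  Whenever the step size drops, smoothness forces it to stay above \<open>G\<^sub>t / L\<close>; hence, if \<open>M\<close> is a
  lower bound on \<open>G\<^sub>1, \<dots>, G\<^sub>t\<close>, iteration \<open>t\<close> decreases \<open>f\<close> by at least \<open>min (M / 4) (M\<^sup>2 / (4 L))\<close>.
  All three rates are instances of this bound. Taking \<open>M = h\<^sub>t\<close> and \<open>h\<^sub>1 \<le> L / 2\<close> gives
  \<open>h\<^sub>t \<le> 4 L / (t + 7)\<close>. Taking the smallest gap for \<open>M\<close> and summing over the second half of the
  iterations, where \<open>h\<close> is already \<open>O(L / t)\<close>, gives the gap bound (without the logarithm).
  Under quadratic growth, let \<open>z\<close> be the minimiser nearest to \<open>x\<^sub>t\<close>, written by Caratheodory's theorem
  with at most \<open>d\<^sup>* + 1\<close> vertices. A greedy argument on 0/1 vertices yields \<open>x\<^sub>t - z = \<Delta> (p - q)\<close> with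
  \<open>p\<close> in the minimal face of \<open>x\<^sub>t\<close>, \<open>q\<close> in \<open>P\<close> and \<open>\<Delta>\<^sup>2 \<le> (d\<^sup>* + 1) \<parallel>x\<^sub>t - z\<parallel>\<^sup>2\<close>, so
  \<open>h\<^sub>t \<le> \<Delta> G\<^sub>t\<close> and \<open>M = max h\<^sub>t (sqrt (\<alpha> h\<^sub>t / (2 (d\<^sup>* + 1))))\<close> is admissible.\<close>

section \<open>Smooth convex functions\<close>

lemma GDERIV_along_line:
  fixes f :: "'a::real_inner \<Rightarrow> real"
  assumes "\<And>y. GDERIV f y :> grad y"
  shows "((\<lambda>s. f (x + s *\<^sub>R d)) has_real_derivative d \<bullet> grad (x + s *\<^sub>R d)) (at s)"
proof -
  have f: "(f has_derivative (\<lambda>h. h \<bullet> grad (x + s *\<^sub>R d))) (at (x + s *\<^sub>R d))"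
    using assms unfolding gderiv_def by blast
  have l: "((\<lambda>s. x + s *\<^sub>R d) has_derivative (\<lambda>h. h *\<^sub>R d)) (at s)"
    by (auto intro!: derivative_eq_intros)
  have "((\<lambda>s. f (x + s *\<^sub>R d)) has_derivative (\<lambda>h. (h *\<^sub>R d) \<bullet> grad (x + s *\<^sub>R d))) (at s)"
    using has_derivative_compose[OF l f] .
  then show ?thesis
    unfolding has_field_derivative_def
    by (rule has_derivative_eq_rhs) (auto simp: fun_eq_iff)
qed

text \<open>The descent lemma: up to the constant \<open>f x\<close>, the difference
  \<open>\<psi>\<close> of the two sides along the segment has nonpositive derivative, by
  Cauchy-Schwarz and the Lipschitz bound.\<close>

lemma smooth_upper_bound:
  fixes f :: "'a::real_inner \<Rightarrow> real"
  assumes grad: "\<And>y. GDERIV f y :> grad y" and lip: "\<beta>-lipschitz_on UNIV grad"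
  shows "f (x + d) \<le> f x + d \<bullet> grad x + \<beta> / 2 * (norm d)\<^sup>2"
proof -
  define \<psi> where "\<psi> s = f (x + s *\<^sub>R d) - s * (d \<bullet> grad x) - \<beta> / 2 * (norm d)\<^sup>2 * s\<^sup>2" for s
  have "\<psi> 1 \<le> \<psi> 0"
  proof (rule DERIV_nonpos_imp_nonincreasing[where f = \<psi>])
    fix s :: real assume s: "0 \<le> s" "s \<le> 1"
    have "(\<psi> has_real_derivative
        d \<bullet> grad (x + s *\<^sub>R d) - d \<bullet> grad x - \<beta> * (norm d)\<^sup>2 * s) (at s)"
      unfolding \<psi>_def
      by (auto intro!: derivative_eq_intros GDERIV_along_line[OF grad])
    moreover have "d \<bullet> grad (x + s *\<^sub>R d) - d \<bullet> grad x \<le> \<beta> * (norm d)\<^sup>2 * s"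
    proof -
      have "d \<bullet> grad (x + s *\<^sub>R d) - d \<bullet> grad x = d \<bullet> (grad (x + s *\<^sub>R d) - grad x)"
        by (simp add: inner_diff_right)
      also have "\<dots> \<le> norm d * norm (grad (x + s *\<^sub>R d) - grad x)"
        by (rule norm_cauchy_schwarz)
      also have "\<dots> \<le> norm d * (\<beta> * norm (s *\<^sub>R d))"
        using lipschitz_onD[OF lip, of "x + s *\<^sub>R d" x]
        by (intro mult_left_mono) (auto simp: dist_norm)
      also have "\<dots> = \<beta> * (norm d)\<^sup>2 * s"
        using s by (simp add: power2_eq_square)
      finally show ?thesis .
    qed
    ultimately show "\<exists>y. (\<psi> has_real_derivative y) (at s) \<and> y \<le> 0"
      by (intro exI conjI) auto
  qed simp
  then show ?thesis by (simp add: \<psi>_def)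
qed

lemma convex_on_line:
  assumes "convex_on UNIV f"
  shows "convex_on UNIV (\<lambda>s::real. f (x + s *\<^sub>R d))"
proof (rule convex_onI)
  fix t a b :: real assume t: "0 < t" "t < 1"
  have "x + ((1 - t) *\<^sub>R a + t *\<^sub>R b) *\<^sub>R d = (1 - t) *\<^sub>R (x + a *\<^sub>R d) + t *\<^sub>R (x + b *\<^sub>R d)"
    by (simp add: algebra_simps)
  then show "f (x + ((1 - t) *\<^sub>R a + t *\<^sub>R b) *\<^sub>R d)
      \<le> (1 - t) * f (x + a *\<^sub>R d) + t * f (x + b *\<^sub>R d)"
    using convex_onD[OF assms, of t "x + a *\<^sub>R d" "x + b *\<^sub>R d"] t by simp
qed simp

lemma convex_lower_bound:
  fixes f :: "'a::real_inner \<Rightarrow> real"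
  assumes "convex_on UNIV f" and grad: "\<And>y. GDERIV f y :> grad y"
  shows "f x + d \<bullet> grad x \<le> f (x + d)"
proof -
  have "((\<lambda>s. f (x + s *\<^sub>R d)) has_real_derivative d \<bullet> grad x) (at 0)"
    using GDERIV_along_line[OF grad, of x d 0] by simp
  from convex_on_imp_above_tangent[OF convex_on_line[OF assms(1), of x d] _ _ _ this, of 1]
  show ?thesis by simp
qed

text \<open>Halving the last accepted step guarantees sufficient decrease: if \<open>\<gamma> / 2\<close> exceeds the
  minimiser \<open>G / L\<close> of the quadratic model, then \<open>\<gamma> / 2\<close> lies between \<open>G / L\<close> and \<open>\<gamma>\<close>, and at
  least half of the weight in this convex combination is on \<open>G / L\<close>.\<close>

lemma half_step_decrease:
  fixes \<phi> :: "real \<Rightarrow> real"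
  assumes conv: "convex_on UNIV \<phi>"
    and quad: "\<And>s. s \<ge> 0 \<Longrightarrow> \<phi> s \<le> \<phi> 0 - s * G + L / 2 * s\<^sup>2"
    and "\<phi> \<gamma> \<le> \<phi> 0" "\<gamma> \<ge> 0" "G \<ge> 0" "L \<ge> 0"
  shows "G * \<gamma> \<le> 4 * (\<phi> 0 - \<phi> (\<gamma> / 2)) \<or> G\<^sup>2 \<le> 4 * L * (\<phi> 0 - \<phi> (\<gamma> / 2))"
\<comment> \<open>Compares \<open>\<gamma> / 2\<close> with the minimiser \<open>G / L\<close>
  without dividing, so \<open>L = 0\<close> falls into the first case. There the model at
  \<open>\<gamma> / 2\<close> already gives a decrease of \<open>G * \<gamma> / 4\<close>.\<close>
proof (cases "L * \<gamma> \<le> 2 * G")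
  case True
  have "\<phi> (\<gamma> / 2) \<le> \<phi> 0 - \<gamma> / 2 * G + L / 2 * (\<gamma> / 2)\<^sup>2"
    using quad[of "\<gamma> / 2"] \<open>\<gamma> \<ge> 0\<close> by simp
  moreover have "(L * \<gamma>) * \<gamma> \<le> (2 * G) * \<gamma>"
    using True \<open>\<gamma> \<ge> 0\<close> by (rule mult_right_mono)
  ultimately have "G * \<gamma> \<le> 4 * (\<phi> 0 - \<phi> (\<gamma> / 2))"
    by (simp add: power2_eq_square algebra_simps)
  then show ?thesis ..
next
  case False
  then have L: "L > 0" and \<gamma>: "\<gamma> > 0"
    using assms(4-6) by (auto simp: less_le)
  define s where "s = G / L"
  define \<mu> where "\<mu> = \<gamma> / (2 * (\<gamma> - s))"
  have s: "0 \<le> s" "s < \<gamma> / 2" "s < \<gamma>"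
  proof -
    show "0 \<le> s" using L \<open>G \<ge> 0\<close> by (simp add: s_def)
    show "s < \<gamma> / 2" using False L by (simp add: s_def pos_divide_less_eq algebra_simps)
    then show "s < \<gamma>" using \<gamma> by simp
  qed
  have \<mu>: "1 / 2 \<le> \<mu>" "\<mu> \<le> 1"
    using s \<gamma> by (auto simp: \<mu>_def field_simps)
  have comb: "(1 - \<mu>) * \<gamma> + \<mu> * s = \<gamma> / 2"
  proof -
    have "\<mu> * (\<gamma> - s) = \<gamma> / 2" using s by (simp add: \<mu>_def divide_simps algebra_simps)
    then show ?thesis by (simp add: algebra_simps)
  qed
  have "\<phi> (\<gamma> / 2) \<le> (1 - \<mu>) * \<phi> \<gamma> + \<mu> * \<phi> s"
    using convex_onD[OF conv, of \<mu> \<gamma> s] \<mu> comb by simp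
  also have "\<dots> \<le> (1 - \<mu>) * \<phi> 0 + \<mu> * (\<phi> 0 - G\<^sup>2 / (2 * L))"
    using quad[of s] s L \<mu> \<open>\<phi> \<gamma> \<le> \<phi> 0\<close>
    by (intro add_mono mult_left_mono) (auto simp: s_def field_simps power2_eq_square)
  also have "\<dots> = \<phi> 0 - \<mu> * (G\<^sup>2 / (2 * L))"
    by (simp add: algebra_simps)
  also have "\<dots> \<le> \<phi> 0 - 1 / 2 * (G\<^sup>2 / (2 * L))"
    using \<mu> L by (intro diff_left_mono mult_right_mono) auto
  finally have "G\<^sup>2 \<le> 4 * L * (\<phi> 0 - \<phi> (\<gamma> / 2))"
    using L by (simp add: field_simps)
  then show ?thesis ..
qed

section \<open>Decomposition in standard polyhedra\<close>

lemma convex_std_polyhedron: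
  fixes A :: "real^'n^'m"
  shows "convex (std_polyhedron A b I)"
proof (rule convexI)
  fix x y :: "real^'n" and u v :: real
  assume *: "x \<in> std_polyhedron A b I" "y \<in> std_polyhedron A b I"
    and uv: "0 \<le> u" "0 \<le> v" "u + v = 1"
  have "A *v (u *\<^sub>R x + v *\<^sub>R y) = u *\<^sub>R b + v *\<^sub>R b"
    using * by (simp add: std_polyhedron_def matrix_vector_right_distrib matrix_vector_mult_scaleR)
  also have "\<dots> = b"
    using uv by (simp flip: scaleR_left_distrib)
  finally show "u *\<^sub>R x + v *\<^sub>R y \<in> std_polyhedron A b I"
    using * uv by (auto simp: std_polyhedron_def)
qed

lemma closed_std_polyhedron:
  fixes A :: "real^'n^'m"
  shows "closed (std_polyhedron A b I)"
proof -
  have "std_polyhedron A b I = {x. A *v x = b} \<inter> (\<Inter>i\<in>I. {x. 0 \<le> x $ i})"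
    by (auto simp: std_polyhedron_def)
  moreover have "closed {x. A *v x = b}"
    by (intro closed_Collect_eq matrix_vector_mult_linear_continuous_on continuous_on_const)
  moreover have "closed {x::real^'n. 0 \<le> x $ i}" for i
    by (intro closed_Collect_le continuous_intros)
  ultimately show ?thesis by (simp add: closed_Int closed_INT)
qed

text \<open>The ray from \<open>y\<close> along \<open>r\<close> never leaves the polyhedron, so
  boundedness excludes a nonzero \<open>r\<close>. This settles the case \<open>\<Delta> = 0\<close>
  of the decomposition below.\<close>

lemma bounded_std_polyhedron_no_recession:
  assumes bdd: "bounded (std_polyhedron A b I)" and y: "y \<in> std_polyhedron A b I"
    and r: "A *v r = 0" "\<forall>i\<in>I. 0 \<le> r $ i"
  shows "r = 0"
proof (rule ccontr)
  assume "r \<noteq> 0"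
  obtain B where B: "\<And>z. z \<in> std_polyhedron A b I \<Longrightarrow> norm z \<le> B"
    using bdd by (auto simp: bounded_iff)
  have "0 \<le> B" using B[OF y] norm_ge_zero order_trans by blast
  define s where "s = (B + norm y + 1) / norm r"
  have s: "s \<ge> 0" "s * norm r = B + norm y + 1"
    using \<open>0 \<le> B\<close> \<open>r \<noteq> 0\<close> by (auto simp: s_def)
  have "y + s *\<^sub>R r \<in> std_polyhedron A b I"
    using y r s(1)
    by (auto simp: std_polyhedron_def matrix_vector_right_distrib matrix_vector_mult_scaleR)
  then have "norm (y + s *\<^sub>R r) \<le> B" by (rule B)
  moreover have "norm (s *\<^sub>R r) \<le> norm (y + s *\<^sub>R r) + norm y"
    by (metis add_diff_cancel_left' norm_triangle_ineq4)
  ultimately show False using s by simp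
qed

text \<open>Entries indexed by \<open>I\<close> are nonnegative on the polyhedron, so one that
  vanishes inside an open segment vanishes at both ends.\<close>

lemma face_of_min_face: "min_face (std_polyhedron A b I) I x face_of std_polyhedron A b I"
  unfolding face_of_def
proof (intro conjI ballI impI)
  let ?P = "std_polyhedron A b I"
  show "min_face ?P I x \<subseteq> ?P" by (auto simp: min_face_def)
  have "min_face ?P I x = ?P \<inter> (\<Inter>i\<in>{i\<in>I. x $ i = 0}. {y. axis i 1 \<bullet> y = 0})"
    by (auto simp: min_face_def inner_axis')
  then show "convex (min_face ?P I x)"
    by (auto intro!: convex_Int convex_std_polyhedron convex_INT convex_hyperplane)
  fix p q y
  assume pq: "p \<in> ?P" "q \<in> ?P" and y: "y \<in> min_face ?P I x" and seg: "y \<in> open_segment p q"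
  obtain u where u: "0 < u" "u < 1" "y = (1 - u) *\<^sub>R p + u *\<^sub>R q"
    using seg by (auto simp: in_segment)
  have "p $ i = 0 \<and> q $ i = 0" if i: "i \<in> I" "x $ i = 0" for i
  proof -
    have "(1 - u) * p $ i + u * q $ i = 0"
      using y i u(3) by (auto simp: min_face_def)
    moreover have "0 \<le> p $ i" "0 \<le> q $ i"
      using pq i by (auto simp: std_polyhedron_def)
    ultimately show ?thesis
      using u(1,2) by (simp add: add_nonneg_eq_0_iff)
  qed
  then show "p \<in> min_face ?P I x" "q \<in> min_face ?P I x"
    using pq by (auto simp: min_face_def)
qed

text \<open>Greedily keep as much of each weight \<open>\<kappa> v\<close> as the bound \<open>x\<close> permits; a weight that is
  cut meets a coordinate that is already exhausted.\<close>

lemma greedy_common_part: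
  fixes x :: "real^'n" and \<kappa> :: "real^'n \<Rightarrow> real"
  assumes "finite S" "\<forall>v\<in>S. \<forall>i\<in>I. v $ i \<in> {0, 1}" "\<forall>v\<in>S. 0 \<le> \<kappa> v" "\<forall>i\<in>I. 0 \<le> x $ i"
  shows "\<exists>\<mu>. (\<forall>v\<in>S. 0 \<le> \<mu> v \<and> \<mu> v \<le> \<kappa> v) \<and> (\<forall>i\<in>I. (\<Sum>v\<in>S. \<mu> v * v $ i) \<le> x $ i) \<and>
    (\<forall>v\<in>S. \<mu> v = \<kappa> v \<or> (\<exists>i\<in>I. v $ i = 1 \<and> (\<Sum>v\<in>S. \<mu> v * v $ i) = x $ i))"
  using assms
proof (induction S)
  case empty
  then show ?case by auto
next
  case (insert w S)
  obtain \<mu> where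
    \<mu>: "\<forall>v\<in>S. 0 \<le> \<mu> v \<and> \<mu> v \<le> \<kappa> v" "\<forall>i\<in>I. (\<Sum>v\<in>S. \<mu> v * v $ i) \<le> x $ i"
      "\<forall>v\<in>S. \<mu> v = \<kappa> v \<or> (\<exists>i\<in>I. v $ i = 1 \<and> (\<Sum>v\<in>S. \<mu> v * v $ i) = x $ i)"
    using insert.IH insert.prems by auto
  \<comment> \<open>\<open>T\<close> holds the full weight of \<open>w\<close> and the slack in each
    coordinate of \<open>I\<close> where \<open>w\<close> has entry 1. Its minimum is the largest
    weight \<open>w\<close> may keep; being attained, it leaves \<open>w\<close> uncut or exhausts a
    coordinate.\<close>
  define T where "T = insert (\<kappa> w) ((\<lambda>i. x $ i - (\<Sum>v\<in>S. \<mu> v * v $ i)) ` {i\<in>I. w $ i = 1})"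
  define m where "m = Min T"
  have T: "finite T" "T \<noteq> {}" by (auto simp: T_def)
  have m_in: "m \<in> T" unfolding m_def using T by (rule Min_in)
  have m_le: "m \<le> z" if "z \<in> T" for z unfolding m_def using T(1) that by (rule Min_le)
  have m0: "0 \<le> m"
    using m_in \<mu>(2) insert.prems(2) by (auto simp: T_def)
  define \<mu>' where "\<mu>' = \<mu>(w := m)"
  have sum_eq: "(\<Sum>v\<in>insert w S. \<mu>' v * v $ i) = m * w $ i + (\<Sum>v\<in>S. \<mu> v * v $ i)" for i
    using insert.hyps by (auto simp: \<mu>'_def intro!: sum.cong)
  have w01: "w $ i = 0 \<or> w $ i = 1" if "i \<in> I" for i
    using insert.prems(1) that by auto
  have bound: "(\<Sum>v\<in>insert w S. \<mu>' v * v $ i) \<le> x $ i" if i: "i \<in> I" for i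
    using w01[OF i] m_le[of "x $ i - (\<Sum>v\<in>S. \<mu> v * v $ i)"] i \<mu>(2)
    unfolding sum_eq by (auto simp: T_def)
  have "\<mu>' v = \<kappa> v \<or> (\<exists>i\<in>I. v $ i = 1 \<and> (\<Sum>v\<in>insert w S. \<mu>' v * v $ i) = x $ i)"
    if v: "v \<in> insert w S" for v
  proof (cases "v = w")
    case True
    then show ?thesis
      using m_in unfolding sum_eq by (auto simp: T_def \<mu>'_def)
  next
    case False
    then have "v \<in> S" using v by auto
    then consider "\<mu> v = \<kappa> v" | i where "i \<in> I" "v $ i = 1" "(\<Sum>v\<in>S. \<mu> v * v $ i) = x $ i"
      using \<mu>(3) by blast
    then show ?thesis
    proof cases
      case 1
      then show ?thesis using False by (simp add: \<mu>'_def)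
    next
      case (2 i)
      have "x $ i \<le> (\<Sum>v\<in>insert w S. \<mu>' v * v $ i)"
        using w01[OF 2(1)] m0 2(3) unfolding sum_eq by auto
      then show ?thesis using bound[OF 2(1)] 2 by force
    qed
  qed
  moreover have "\<forall>v\<in>insert w S. 0 \<le> \<mu>' v \<and> \<mu>' v \<le> \<kappa> v"
    using \<mu>(1) m0 m_le[of "\<kappa> w"] insert.hyps by (auto simp: \<mu>'_def T_def)
  ultimately show ?case using bound by blast
qed

text \<open>Each cut point is charged to one exhausted coordinate \<open>j\<close> where its entry
  is 1. The mass charged to \<open>j\<close> is at most \<open>y $ j - x $ j\<close>, because the
  kept part already fills \<open>x $ j\<close>. At most \<open>card S\<close> coordinates are
  charged, so Cauchy-Schwarz turns the sum into the Euclidean norm.\<close>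

lemma transported_mass_le:
  fixes x y :: "real^'n" and \<kappa> :: "real^'n \<Rightarrow> real"
  assumes S: "finite S" "\<forall>v\<in>S. \<forall>i\<in>I. v $ i \<in> {0, 1}" "\<forall>v\<in>S. 0 \<le> \<kappa> v"
    and y: "y = (\<Sum>v\<in>S. \<kappa> v *\<^sub>R v)"
    and \<mu>: "\<forall>v\<in>S. 0 \<le> \<mu> v \<and> \<mu> v \<le> \<kappa> v"
      "\<forall>v\<in>S. \<mu> v = \<kappa> v \<or> (\<exists>i\<in>I. v $ i = 1 \<and> (\<Sum>v\<in>S. \<mu> v * v $ i) = x $ i)"
  shows "(\<Sum>v\<in>S. \<kappa> v - \<mu> v)\<^sup>2 \<le> card S * (norm (x - y))\<^sup>2"
proof -
  define R where "R = {v\<in>S. \<mu> v \<noteq> \<kappa> v}"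
  have "\<forall>v\<in>R. \<exists>i. i \<in> I \<and> v $ i = 1 \<and> (\<Sum>v\<in>S. \<mu> v * v $ i) = x $ i"
    using \<mu>(2) by (auto simp: R_def)
  then obtain k where k: "\<And>v. v \<in> R \<Longrightarrow> k v \<in> I \<and> v $ k v = 1 \<and> (\<Sum>u\<in>S. \<mu> u * u $ k v) = x $ k v"
    by metis
  have R: "finite R" "R \<subseteq> S" using S(1) by (auto simp: R_def)
  define J where "J = k ` R"
  have J: "finite J" "card J \<le> card S"
    using R S(1) card_image_le[OF R(1), of k] card_mono[OF S(1) R(2)] by (auto simp: J_def)
  have "(\<Sum>v\<in>S. \<kappa> v - \<mu> v) = (\<Sum>v\<in>R. \<kappa> v - \<mu> v)"
    using S(1) by (intro sum.mono_neutral_right) (auto simp: R_def)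
  also have "\<dots> = (\<Sum>j\<in>J. \<Sum>v\<in>{v\<in>R. k v = j}. \<kappa> v - \<mu> v)"
    unfolding J_def using R(1) by (rule sum.image_gen)
  also have "\<dots> \<le> (\<Sum>j\<in>J. y $ j - x $ j)"
  proof (rule sum_mono)
    fix j assume "j \<in> J"
    then have j: "j \<in> I" "(\<Sum>u\<in>S. \<mu> u * u $ j) = x $ j"
      using k by (auto simp: J_def)
    have "(\<Sum>v\<in>{v\<in>R. k v = j}. \<kappa> v - \<mu> v) = (\<Sum>v\<in>{v\<in>R. k v = j}. (\<kappa> v - \<mu> v) * v $ j)"
      using k by (intro sum.cong) auto
    also have "\<dots> \<le> (\<Sum>v\<in>S. (\<kappa> v - \<mu> v) * v $ j)"
    proof (rule sum_mono2)
      show "0 \<le> (\<kappa> v - \<mu> v) * v $ j" if "v \<in> S - {v\<in>R. k v = j}" for v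
      proof -
        have "v $ j = 0 \<or> v $ j = 1" "\<mu> v \<le> \<kappa> v" using that S(2) \<mu>(1) j(1) by auto
        then show ?thesis by auto
      qed
    qed (use S(1) R in auto)
    also have "\<dots> = y $ j - x $ j"
      unfolding y by (simp add: left_diff_distrib sum_subtractf j(2))
    finally show "(\<Sum>v\<in>{v\<in>R. k v = j}. \<kappa> v - \<mu> v) \<le> y $ j - x $ j" .
  qed
  finally have "(\<Sum>v\<in>S. \<kappa> v - \<mu> v)\<^sup>2 \<le> (\<Sum>j\<in>J. y $ j - x $ j)\<^sup>2"
    using \<mu>(1) by (intro power_mono sum_nonneg) auto
  also have "\<dots> \<le> (\<Sum>j\<in>J. (y $ j - x $ j)\<^sup>2) * card J"
    by (rule sum_squared_le_sum_of_squares)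
  also have "\<dots> \<le> (\<Sum>j\<in>UNIV. (y $ j - x $ j)\<^sup>2) * card S"
    using J by (intro mult_mono sum_mono2 sum_nonneg) auto
  also have "(\<Sum>j\<in>UNIV. (y $ j - x $ j)\<^sup>2) = (norm (x - y))\<^sup>2"
    unfolding power2_norm_eq_inner inner_vec_def
    by (intro sum.cong) (auto simp: power2_eq_square algebra_simps)
  finally show ?thesis by (simp add: mult.commute)
qed

text \<open>\<open>w\<close> is the part common to \<open>x\<close> and \<open>y\<close>. The
  remainders \<open>x - w\<close> and \<open>y - w\<close> carry mass \<open>\<Delta>\<close>:
  divided by a nonzero \<open>\<Delta>\<close>, the first lies in the minimal face of
  \<open>x\<close>, as its entries on \<open>I\<close> are between 0 and those of \<open>x\<close>,
  and the second is a convex combination of \<open>S\<close>.\<close>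

lemma decomposition_invariant_bound:
  fixes A :: "real^'n^'m" and b :: "real^'m" and I :: "'n set" and g :: "real^'n"
  defines "P \<equiv> std_polyhedron A b I"
  assumes bdd: "bounded P" and x: "x \<in> P"
    and S: "finite S" "S \<subseteq> P" "\<forall>v\<in>S. \<forall>i\<in>I. v $ i \<in> {0, 1}" and y: "y \<in> convex hull S"
    and upper: "\<And>p. p \<in> min_face P I x \<Longrightarrow> p \<bullet> g \<le> M"
    and lower: "\<And>q. q \<in> P \<Longrightarrow> m \<le> q \<bullet> g"
  obtains \<Delta> where "\<Delta> \<ge> 0" "\<Delta>\<^sup>2 \<le> card S * (norm (x - y))\<^sup>2" "(x - y) \<bullet> g \<le> \<Delta> * (M - m)"
proof -
  obtain \<kappa> where \<kappa>: "\<forall>v\<in>S. 0 \<le> \<kappa> v" "sum \<kappa> S = 1" "(\<Sum>v\<in>S. \<kappa> v *\<^sub>R v) = y"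
    using y S(1) by (auto simp: convex_hull_finite)
  have x0: "\<forall>i\<in>I. 0 \<le> x $ i" and Ax: "A *v x = b"
    using x by (auto simp: P_def std_polyhedron_def)
  obtain \<mu> where \<mu>: "\<forall>v\<in>S. 0 \<le> \<mu> v \<and> \<mu> v \<le> \<kappa> v" "\<forall>i\<in>I. (\<Sum>v\<in>S. \<mu> v * v $ i) \<le> x $ i"
    "\<forall>v\<in>S. \<mu> v = \<kappa> v \<or> (\<exists>i\<in>I. v $ i = 1 \<and> (\<Sum>v\<in>S. \<mu> v * v $ i) = x $ i)"
    using greedy_common_part[OF S(1,3) \<kappa>(1) x0] by blast
  define \<Delta> where "\<Delta> = (\<Sum>v\<in>S. \<kappa> v - \<mu> v)"
  define w where "w = (\<Sum>v\<in>S. \<mu> v *\<^sub>R v)"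
  define r where "r = x - w"
  have \<Delta>0: "\<Delta> \<ge> 0" unfolding \<Delta>_def using \<mu>(1) by (intro sum_nonneg) auto
  have \<Delta>2: "\<Delta>\<^sup>2 \<le> card S * (norm (x - y))\<^sup>2"
    unfolding \<Delta>_def using transported_mass_le[OF S(1,3) \<kappa>(1) \<kappa>(3)[symmetric] \<mu>(1,3)] .
  have "A *v w = (\<Sum>v\<in>S. \<mu> v *\<^sub>R (A *v v))"
    unfolding w_def using matrix_vector_mul_linear[of A]
    by (simp add: linear_sum matrix_vector_mult_scaleR)
  also have "\<dots> = (\<Sum>v\<in>S. \<mu> v *\<^sub>R b)"
    using S(2) by (intro sum.cong) (auto simp: P_def std_polyhedron_def)
  also have "\<dots> = (1 - \<Delta>) *\<^sub>R b"
    using \<kappa>(2) by (simp add: \<Delta>_def sum_subtractf flip: scaleR_left.sum)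
  finally have Ar: "A *v r = \<Delta> *\<^sub>R b"
    by (simp add: r_def matrix_vector_mult_diff_distrib Ax scaleR_left_diff_distrib)
  have w0: "0 \<le> w $ i" if "i \<in> I" for i
    unfolding w_def using \<mu>(1) S(3) that by (auto intro!: sum_nonneg mult_nonneg_nonneg) force
  have r0: "0 \<le> r $ i" "r $ i \<le> x $ i" if "i \<in> I" for i
    using \<mu>(2) w0[OF that] that by (auto simp: r_def w_def)
  have "r \<bullet> g \<le> \<Delta> * M"
  proof (cases "\<Delta> = 0")
    case True
    then have "r = 0"
      using bounded_std_polyhedron_no_recession[of A b I x r] bdd x Ar r0(1) by (auto simp: P_def)
    then show ?thesis using True by simp
  next
    case False
    then have "(1 / \<Delta>) *\<^sub>R r \<in> min_face P I x"
      using Ar r0 \<Delta>0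
      by (auto simp: min_face_def P_def std_polyhedron_def matrix_vector_mult_scaleR)
        (metis order_antisym)
    then have "((1 / \<Delta>) *\<^sub>R r) \<bullet> g \<le> M" by (rule upper)
    then show ?thesis using False \<Delta>0 by (simp add: field_simps)
  qed
  moreover have "\<Delta> * m \<le> (y - w) \<bullet> g"
  proof -
    have "\<Delta> * m = (\<Sum>v\<in>S. (\<kappa> v - \<mu> v) * m)"
      by (simp add: \<Delta>_def sum_distrib_right)
    also have "\<dots> \<le> (\<Sum>v\<in>S. (\<kappa> v - \<mu> v) * (v \<bullet> g))"
      using \<mu>(1) S(2) lower by (intro sum_mono mult_left_mono) auto
    also have "\<dots> = (y - w) \<bullet> g"
      by (simp add: w_def \<kappa>(3)[symmetric] inner_diff_left inner_sum_left left_diff_distrib sum_subtractf)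
    finally show ?thesis .
  qed
  ultimately have "(x - y) \<bullet> g \<le> \<Delta> * (M - m)"
    by (simp add: r_def algebra_simps)
  with that \<Delta>0 \<Delta>2 show thesis by blast
qed

section \<open>The iteration\<close>

locale pdicg =
  fixes A :: "real^'n^'m" and b :: "real^'m" and I :: "'n set"
    and P :: "(real^'n) set"
    and f :: "real^'n \<Rightarrow> real" and grad :: "real^'n \<Rightarrow> real^'n" and \<beta> :: real
    and x0 :: "real^'n" and x vp vm :: "nat \<Rightarrow> real^'n" and \<eta> :: "nat \<Rightarrow> real"
  assumes P_eq: "P = std_polyhedron A b I"
    and bounded_P: "bounded P"
    and vertices_01: "\<forall>v\<in>vertices P. \<forall>i\<in>I. v $ i \<in> {0, 1}"
    and convex_f: "convex_on UNIV f"
    and gderiv_f: "\<And>y. GDERIV f y :> grad y"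
    and lipschitz_grad: "\<beta>-lipschitz_on UNIV grad"
    and run: "pdicg_run f grad P I x vp vm \<eta>"
    and x0: "x0 \<in> P"
    and x1: "is_arg_min (\<lambda>v. v \<bullet> grad x0) (\<lambda>v. v \<in> vertices P) (x 1)"
begin

abbreviation "gen t \<equiv> generated grad x vp t"
abbreviation "gap t \<equiv> fw_gap grad x vp t"
definition "h t = f (x t) - opt_val f P"
text \<open>\<open>vm t\<close> is constrained only if iteration \<open>t\<close> does not stop, so
  \<open>d t\<close> and \<open>G t\<close> are meaningful only under
  \<open>gen (Suc t)\<close>.\<close>

definition "d t = vp t - vm t"
definition "G t = - (d t \<bullet> grad (x t))"
definition "L = \<beta> * (diameter P)\<^sup>2"

section \<open>Faces of the polytope and minimisers of \<open>f\<close>\<close>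

lemma convex_P: "convex P" and compact_P: "compact P"
  using convex_std_polyhedron closed_std_polyhedron bounded_P
  by (auto simp: P_eq compact_eq_bounded_closed)

lemma vertices_subset: "vertices P \<subseteq> P"
  by (auto simp: vertices_def extreme_point_of_def)

text \<open>Krein-Milman for the compact face, whose extreme points are the vertices of
  \<open>P\<close> inside it.\<close>

lemma face_eq_hull_vertices: "F face_of P \<Longrightarrow> F = convex hull (vertices P \<inter> F)"
  using Krein_Milman_Minkowski[of F] face_of_imp_compact[OF convex_P compact_P]
  by (auto simp: vertices_def extreme_point_of_face face_of_imp_convex Int_def)

text \<open>Makes the algorithm's choices among vertices optimal over the whole face.\<close>

lemma face_inner_le:
  assumes "F face_of P" "p \<in> F" "\<And>v. v \<in> vertices P \<inter> F \<Longrightarrow> v \<bullet> c \<le> M"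
  shows "p \<bullet> c \<le> M"
proof -
  have "convex hull (vertices P \<inter> F) \<subseteq> {y. c \<bullet> y \<le> M}"
    using assms(3) by (intro hull_minimal convex_halfspace_le) (auto simp: inner_commute)
  then show ?thesis
    using face_eq_hull_vertices[OF assms(1)] assms(2) by (auto simp: inner_commute)
qed

lemma inner_ge_vertices:
  assumes "q \<in> P" "\<And>v. v \<in> vertices P \<Longrightarrow> m \<le> v \<bullet> c"
  shows "m \<le> q \<bullet> c"
  using face_inner_le[OF face_of_refl[OF convex_P] assms(1), of "- c" "- m"] assms(2) by auto

lemma norm_diff_le_diameter: "p \<in> P \<Longrightarrow> q \<in> P \<Longrightarrow> norm (p - q) \<le> diameter P"
  using diameter_bounded_bound[OF bounded_P] by (simp add: dist_norm)

lemma L_nonneg: "L \<ge> 0"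
  using lipschitz_on_nonneg[OF lipschitz_grad] by (simp add: L_def)

lemma continuous_f: "continuous_on UNIV f"
proof (rule has_derivative_continuous_on)
  show "(f has_derivative (\<lambda>h. h \<bullet> grad y)) (at y within UNIV)" for y
    using gderiv_f by (simp add: gderiv_def)
qed

lemma opt_val_attained: "\<exists>z\<in>P. f z = opt_val f P"
  and opt_val_le: "y \<in> P \<Longrightarrow> opt_val f P \<le> f y"
proof -
  obtain z where z: "z \<in> P" "\<And>y. y \<in> P \<Longrightarrow> f z \<le> f y"
    using continuous_attains_inf[OF compact_P _ continuous_on_subset[OF continuous_f]] x0 by blast
  have "opt_val f P = f z"
    unfolding opt_val_def using z by (intro cInf_eq_minimum) auto
  then show "\<exists>z\<in>P. f z = opt_val f P" "y \<in> P \<Longrightarrow> opt_val f P \<le> f y"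
    using z by auto
qed

lemma opt_set_eq: "opt_set f P = {z \<in> P. f z \<le> opt_val f P}"
proof -
  obtain z where z: "z \<in> P" "f z = opt_val f P" using opt_val_attained by blast
  show ?thesis
    using z opt_val_le by (auto simp: opt_set_def is_arg_min_linorder) (metis order_trans)
qed

lemma infdist_opt_set_attained:
  obtains z where "z \<in> opt_set f P" "infdist y (opt_set f P) = norm (y - z)"
proof -
  have "closed (P \<inter> {z. f z \<le> opt_val f P})"
    using compact_imp_closed[OF compact_P] continuous_f
    by (intro closed_Int closed_Collect_le continuous_on_const)
  moreover have "P \<inter> {z. f z \<le> opt_val f P} = opt_set f P"
    by (auto simp: opt_set_eq)
  moreover have "opt_set f P \<noteq> {}"
    using opt_val_attained unfolding opt_set_eq by force
  ultimately show thesis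
    using infdist_attains_inf[of "opt_set f P" y] that by (auto simp: dist_norm)
qed

section \<open>Single iterations and feasibility\<close>

lemma gen_Suc: "t \<ge> 1 \<Longrightarrow> gen (Suc t) \<longleftrightarrow> gen t \<and> gap t \<noteq> 0"
  by (auto simp: generated_def less_Suc_eq)

lemma gen_antimono: "gen t \<Longrightarrow> 1 \<le> s \<Longrightarrow> s \<le> t \<Longrightarrow> gen s"
  by (auto simp: generated_def)

lemma x1_vertex: "x 1 \<in> vertices P" and eta1: "\<eta> 1 = 1"
  using run by (auto simp: pdicg_run_def)

lemma vp_vertex: "gen t \<Longrightarrow> vp t \<in> vertices P"
  using run by (auto simp: pdicg_run_def is_arg_min_linorder)

lemma vp_min:
  assumes "gen t" "q \<in> P"
  shows "vp t \<bullet> grad (x t) \<le> q \<bullet> grad (x t)"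
proof (rule inner_ge_vertices[OF assms(2)])
  show "vp t \<bullet> grad (x t) \<le> v \<bullet> grad (x t)" if "v \<in> vertices P" for v
    using run assms(1) that by (auto simp: pdicg_run_def is_arg_min_linorder)
qed

context
  fixes t :: nat
  assumes t: "t \<ge> 1" and step: "gen (Suc t)"
begin

lemma gen_t: "gen t"
  using step gen_Suc[OF t] by auto

lemma vm_in: "vm t \<in> vertices P" "vm t \<in> min_face P I (x t)"
  and x_Suc: "x (Suc t) = x t + (\<eta> (Suc t) / 2) *\<^sub>R d t"
  using run gen_t step gen_Suc[OF t] by (auto simp: pdicg_run_def is_arg_max_def d_def)

lemma vm_max:
  assumes "p \<in> min_face P I (x t)"
  shows "p \<bullet> grad (x t) \<le> vm t \<bullet> grad (x t)"
proof (rule face_inner_le[OF _ assms])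
  show "min_face P I (x t) face_of P"
    unfolding P_eq by (rule face_of_min_face)
  have "is_arg_max (\<lambda>v. v \<bullet> grad (x t)) (\<lambda>v. v \<in> vertices P \<inter> min_face P I (x t)) (vm t)"
    using run gen_t step gen_Suc[OF t] unfolding pdicg_run_def by blast
  then show "v \<bullet> grad (x t) \<le> vm t \<bullet> grad (x t)" if "v \<in> vertices P \<inter> min_face P I (x t)" for v
    using that by (simp add: is_arg_max_linorder)
qed

text \<open>\<open>j\<close> counts the halvings made in iteration \<open>t\<close>. After at least
  one halving the doubled step still respects \<open>\<eta> t\<close>; if it decreased
  \<open>f\<close>, minimality of the chosen exponent \<open>i\<close> would be violated by
  \<open>i - 1\<close>.\<close>

lemma eta_Suc:
  assumes "\<eta> t = 1 / 2 ^ k"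
  obtains j where "\<eta> (Suc t) = 1 / 2 ^ (k + j)" "f (x t + \<eta> (Suc t) *\<^sub>R d t) < f (x t)"
    "j = 0 \<or> f (x t) \<le> f (x t + (2 * \<eta> (Suc t)) *\<^sub>R d t)"
proof -
  obtain i where i: "is_arg_min id (dyadic_descent f (\<eta> t) (x t) (d t)) i" "\<eta> (Suc t) = 2 powi (- i)"
    using run gen_t step gen_Suc[OF t] by (auto simp: pdicg_run_def d_def)
  have desc: "\<eta> (Suc t) \<le> \<eta> t" "f (x t + \<eta> (Suc t) *\<^sub>R d t) < f (x t)"
    using i by (auto simp: is_arg_min_def dyadic_descent_def)
  have min: "i \<le> i'" if "dyadic_descent f (\<eta> t) (x t) (d t) i'" for i'
    using i(1) that by (auto simp: is_arg_min_linorder)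
  have pw: "1 / 2 ^ n = (2::real) powi (- int n)" for n
    by (simp add: power_int_minus inverse_eq_divide)
  have "int k \<le> i"
  proof (rule ccontr)
    assume "\<not> int k \<le> i"
    then have "(2::real) powi (- int k) < 2 powi (- i)"
      by (intro power_int_strict_increasing) auto
    then show False using desc(1) i(2) assms pw by simp
  qed
  define j where "j = nat (i - int k)"
  have j: "i = int (k + j)" using \<open>int k \<le> i\<close> by (simp add: j_def)
  have eta: "\<eta> (Suc t) = 1 / 2 ^ (k + j)" unfolding pw using i(2) j by simp
  have "f (x t) \<le> f (x t + (2 * \<eta> (Suc t)) *\<^sub>R d t)" if pos: "j > 0"
  proof (rule ccontr)
    assume less: "\<not> ?thesis"
    obtain j' where j': "j = Suc j'" using pos gr0_implies_Suc by blast
    have two: "(2::real) powi (- (i - 1)) = 2 * \<eta> (Suc t)"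
      unfolding i(2) by (simp add: power_int_diff power_int_minus field_simps)
    have "2 * \<eta> (Suc t) = 1 / 2 ^ (k + j')"
      unfolding eta j' by simp
    then have "2 * \<eta> (Suc t) \<le> \<eta> t"
      unfolding assms by (simp add: frac_le power_increasing)
    then have "dyadic_descent f (\<eta> t) (x t) (d t) (i - 1)"
      using less two by (simp add: dyadic_descent_def)
    from min[OF this] show False by simp
  qed
  with that eta desc(2) show thesis by blast
qed

end

text \<open>The entries indexed by \<open>I\<close> stay multiples of the half step, so a step that decreases a
  positive entry by one half step cannot make it negative.\<close>

lemma feasible_dyadic:
  assumes "gen t"
  shows "x t \<in> P \<and> (\<exists>k::nat. \<eta> t = 1 / 2 ^ k) \<and> (\<forall>i\<in>I. \<exists>n::int. x t $ i = n * (\<eta> t / 2))"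
proof -
  have "1 \<le> t" using assms by (simp add: generated_def)
  then show ?thesis using assms
  proof (induction t rule: dec_induct)
    case base
    have "\<exists>n::int. x 1 $ i = n * (\<eta> 1 / 2)" if "i \<in> I" for i
    proof -
      have "x 1 $ i = 0 \<or> x 1 $ i = 1" using vertices_01 x1_vertex that by auto
      then show ?thesis
        unfolding eta1 by (auto intro: exI[of _ 0] exI[of _ 2])
    qed
    then show ?case
      using x1_vertex vertices_subset eta1 by (auto intro: exI[of _ 0])
  next
    case (step t)
    note s = step.hyps(1) step.prems
    have IH: "x t \<in> P" "\<forall>i\<in>I. \<exists>n::int. x t $ i = n * (\<eta> t / 2)"
      using step.IH gen_t[OF s] by auto
    obtain k where k: "\<eta> t = 1 / 2 ^ k" using step.IH gen_t[OF s] by auto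
    obtain j where j: "\<eta> (Suc t) = 1 / 2 ^ (k + j)" using eta_Suc[OF s k] by blast
    have eta: "\<eta> t = 2 ^ j * \<eta> (Suc t)" "\<eta> (Suc t) > 0"
      unfolding k j by (simp_all add: power_add)
    have entry: "\<exists>n. (0::int) \<le> n \<and> x (Suc t) $ i = n * (\<eta> (Suc t) / 2)" if i: "i \<in> I" for i
    proof -
      obtain n :: int where n: "x t $ i = n * (\<eta> t / 2)" using IH(2) i by blast
      have "0 \<le> x t $ i" using IH(1) i by (auto simp: P_eq std_polyhedron_def)
      moreover have "0 < \<eta> t" using eta by simp
      ultimately have n0: "0 \<le> n"
        using n by (simp add: zero_le_mult_iff)
      have int01: "\<exists>p::int. r = of_int p \<and> p \<in> {0::int, 1}" if "r \<in> {0, 1}" for r :: real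
        using that by (auto intro: exI[of _ 0] exI[of _ 1])
      have "vp t $ i \<in> {0, 1}" "vm t $ i \<in> {0, 1}"
        using vertices_01 vp_vertex[OF gen_t[OF s]] vm_in(1)[OF s] i by auto
      from this[THEN int01] obtain p q :: int
        where pq: "vp t $ i = p" "p \<in> {0, 1}" "vm t $ i = q" "q \<in> {0, 1}" by blast
      \<comment> \<open>\<open>vm t\<close> lies in the minimal face of \<open>x t\<close>, so it
        has entry 1 only where \<open>x t\<close> is nonzero; there at least one unit is
        available.\<close>
      have "n \<noteq> 0" if "q = 1"
        using vm_in(2)[OF s] i n pq(3) that by (auto simp: min_face_def)
      then have "0 < n * 2 ^ j" if "q = 1" using n0 that by simp
      moreover have "0 \<le> n * 2 ^ j" using n0 by simp
      ultimately have "q \<le> n * 2 ^ j" using pq(4) by auto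
      then have "0 \<le> n * 2 ^ j + p - q" using pq(2) by auto
      \<comment> \<open>In units of the new half step, the old entry counts \<open>n * 2 ^ j\<close>
        and the move adds \<open>p - q\<close>.\<close>
      moreover have "x (Suc t) $ i = real_of_int (n * 2 ^ j + p - q) * (\<eta> (Suc t) / 2)"
        unfolding x_Suc[OF s] by (simp add: n pq d_def eta(1) algebra_simps)
      ultimately show ?thesis by blast
    qed
    have "A *v d t = 0"
      using vp_vertex[OF gen_t[OF s]] vm_in(1)[OF s] vertices_subset
      by (auto simp: d_def P_eq std_polyhedron_def matrix_vector_mult_diff_distrib)
    then have "A *v x (Suc t) = b"
      unfolding x_Suc[OF s] using IH(1)
      by (simp add: P_eq std_polyhedron_def matrix_vector_right_distrib matrix_vector_mult_scaleR)
    moreover have "0 \<le> x (Suc t) $ i" if i: "i \<in> I" for i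
    proof -
      obtain n :: int where n: "0 \<le> n" "x (Suc t) $ i = n * (\<eta> (Suc t) / 2)"
        using entry[OF i] by blast
      show ?thesis
        unfolding n(2) using n(1) eta(2) by (intro mult_nonneg_nonneg) auto
    qed
    ultimately have "x (Suc t) \<in> P"
      by (simp add: P_eq std_polyhedron_def)
    then show ?case using j entry by blast
  qed
qed

lemmas x_in_P = feasible_dyadic[THEN conjunct1]
lemmas eta_dyadic = feasible_dyadic[THEN conjunct2, THEN conjunct1]

section \<open>Gaps and the decrease in one iteration\<close>

lemma h_nonneg: "gen t \<Longrightarrow> 0 \<le> h t"
  using opt_val_le x_in_P by (auto simp: h_def)

text \<open>Convexity bounds \<open>h t\<close> by the slope towards a minimiser, and
  \<open>vp t\<close> minimises the linearisation over all of \<open>P\<close>.\<close>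

lemma h_le_gap: "gen t \<Longrightarrow> h t \<le> gap t"
proof -
  assume g: "gen t"
  obtain z where z: "z \<in> P" "f z = opt_val f P" using opt_val_attained by blast
  show "h t \<le> gap t"
    using convex_lower_bound[OF convex_f gderiv_f, of "x t" "z - x t"] vp_min[OF g z(1)] z(2)
    by (simp add: h_def fw_gap_def inner_diff_left)
qed

context
  fixes t :: nat
  assumes t: "t \<ge> 1" and step: "gen (Suc t)"
begin

text \<open>\<open>x t\<close> belongs to its own minimal face, over which \<open>vm t\<close>
  maximises.\<close>

lemma gap_le_G: "gap t \<le> G t"
proof -
  have "x t \<in> min_face P I (x t)"
    using x_in_P[OF gen_t[OF t step]] by (auto simp: min_face_def)
  from vm_max[OF t step this] show ?thesis
    by (simp add: G_def d_def fw_gap_def inner_diff_left)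
qed

lemma h_le_G: "h t \<le> G t"
  using h_le_gap[OF gen_t[OF t step]] gap_le_G by simp

lemma G_nonneg: "0 \<le> G t"
  using h_le_G h_nonneg[OF gen_t[OF t step]] by simp

lemma line_upper_bound:
  "f (x t + s *\<^sub>R d t) \<le> f (x t) - s * G t + L / 2 * s\<^sup>2"
proof -
  have "norm (d t) \<le> diameter P"
    using norm_diff_le_diameter vertices_subset vp_vertex[OF gen_t[OF t step]] vm_in(1)[OF t step]
    by (auto simp: d_def)
  then have "\<beta> * s\<^sup>2 * (norm (d t))\<^sup>2 \<le> \<beta> * s\<^sup>2 * (diameter P)\<^sup>2"
    using lipschitz_on_nonneg[OF lipschitz_grad] by (intro mult_left_mono power_mono) auto
  then show ?thesis
    using smooth_upper_bound[OF gderiv_f lipschitz_grad, of "x t" "s *\<^sub>R d t"]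
    by (simp add: G_def L_def power_mult_distrib algebra_simps)
qed

text \<open>\<open>half_step_decrease\<close> is applied to \<open>f\<close> along
  \<open>d t\<close>, with the trial step \<open>\<eta> (Suc t)\<close> as \<open>\<gamma>\<close>;
  the iterate moves by half of it. Midpoint convexity passes the strict decrease on to that
  half.\<close>

lemma half_step_progress:
  "G t * \<eta> (Suc t) \<le> 4 * (h t - h (Suc t)) \<or> (G t)\<^sup>2 \<le> 4 * L * (h t - h (Suc t))"
  and h_decreasing: "h (Suc t) < h t"
proof -
  obtain k where k: "\<eta> t = 1 / 2 ^ k" using eta_dyadic[OF gen_t[OF t step]] by blast
  obtain j where j: "\<eta> (Suc t) = 1 / 2 ^ (k + j)" "f (x t + \<eta> (Suc t) *\<^sub>R d t) < f (x t)"
    using eta_Suc[OF t step k] by blast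
  define \<phi> where "\<phi> s = f (x t + s *\<^sub>R d t)" for s
  have conv: "convex_on UNIV \<phi>"
    unfolding \<phi>_def by (rule convex_on_line[OF convex_f])
  have diff: "h t - h (Suc t) = \<phi> 0 - \<phi> (\<eta> (Suc t) / 2)"
    by (simp add: h_def \<phi>_def x_Suc[OF t step])
  show "G t * \<eta> (Suc t) \<le> 4 * (h t - h (Suc t)) \<or> (G t)\<^sup>2 \<le> 4 * L * (h t - h (Suc t))"
    unfolding diff
    using j line_upper_bound G_nonneg L_nonneg
    by (intro half_step_decrease[OF conv]) (auto simp: \<phi>_def)
  show "h (Suc t) < h t"
    using convex_onD[OF conv, of "1 / 2" 0 "\<eta> (Suc t)"] j(2) diff by (simp add: \<phi>_def)
qed

end

text \<open>At the last cut the doubled step failed to decrease \<open>f\<close>, so the quadratic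
  model at \<open>2 * \<gamma>\<close> gives \<open>G \<tau> \<le> L * \<gamma>\<close>, and the
  step size has not changed since. Without any cut it is still 1.\<close>

lemma eta_lower:
  assumes "t \<ge> 1" "gen (Suc t)"
  shows "\<eta> (Suc t) = 1 \<or> (\<exists>\<tau>\<in>{1..t}. G \<tau> \<le> L * \<eta> (Suc t))"
  using assms
proof (induction t)
  case (Suc t)
  note s = Suc.prems
  obtain k where k: "\<eta> (Suc t) = 1 / 2 ^ k" using eta_dyadic[OF gen_t[OF s]] by blast
  obtain j where j: "\<eta> (Suc (Suc t)) = 1 / 2 ^ (k + j)"
    "j = 0 \<or> f (x (Suc t)) \<le> f (x (Suc t) + (2 * \<eta> (Suc (Suc t))) *\<^sub>R d (Suc t))"
    using eta_Suc[OF s k] by blast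
  show ?case
  proof (cases "j = 0")
    case True
    then have eq: "\<eta> (Suc (Suc t)) = \<eta> (Suc t)" using j k by simp
    show ?thesis
    proof (cases "t = 0")
      case True
      then show ?thesis using eq eta1 by simp
    next
      case False
      then show ?thesis using Suc.IH gen_t[OF s] unfolding eq by force
    qed
  next
    case False
    define \<gamma> where "\<gamma> = \<eta> (Suc (Suc t))"
    have \<gamma>: "\<gamma> > 0" by (simp add: \<gamma>_def j)
    have "f (x (Suc t)) \<le> f (x (Suc t)) - (2 * \<gamma>) * G (Suc t) + L / 2 * (2 * \<gamma>)\<^sup>2"
      using j(2) False line_upper_bound[OF s, of "2 * \<gamma>"] by (simp add: \<gamma>_def)
    then have "(2 * \<gamma>) * G (Suc t) \<le> (2 * \<gamma>) * (L * \<gamma>)"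
      by (simp add: power2_eq_square algebra_simps)
    then have "G (Suc t) \<le> L * \<gamma>" using \<gamma> by simp
    then show ?thesis by (auto simp: \<gamma>_def)
  qed
qed simp

text \<open>A short step was forced by some earlier direction, so any common lower bound on the
  pairwise gaps \<open>G\<close> controls the step size as well.\<close>

lemma progress:
  assumes t: "t \<ge> 1" and step: "gen (Suc t)"
    and M: "0 \<le> M" "\<And>\<tau>. \<tau> \<in> {1..t} \<Longrightarrow> M \<le> G \<tau>"
  shows "M \<le> 4 * (h t - h (Suc t)) \<or> M\<^sup>2 \<le> 4 * L * (h t - h (Suc t))"
proof -
  have Mt: "M \<le> G t" using M(2) t by simp
  from half_step_progress[OF t step] show ?thesis
  proof
    assume le: "G t * \<eta> (Suc t) \<le> 4 * (h t - h (Suc t))"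
    from eta_lower[OF t step] show ?thesis
    proof
      assume "\<eta> (Suc t) = 1"
      then show ?thesis using le Mt by simp
    next
      assume "\<exists>\<tau>\<in>{1..t}. G \<tau> \<le> L * \<eta> (Suc t)"
      then have "M \<le> L * \<eta> (Suc t)" using M(2) by force
      \<comment> \<open>One factor is bounded through the step size, the other by
        \<open>G t\<close>, which recreates the product bounded in \<open>le\<close>.\<close>
      then have "M * M \<le> (L * \<eta> (Suc t)) * G t"
        using Mt M(1) by (intro mult_mono) auto
      also have "\<dots> = L * (G t * \<eta> (Suc t))" by simp
      also have "\<dots> \<le> L * (4 * (h t - h (Suc t)))"
        using le L_nonneg by (rule mult_left_mono)
      finally have "M\<^sup>2 \<le> 4 * L * (h t - h (Suc t))"
        by (simp add: power2_eq_square algebra_simps)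
      then show ?thesis ..
    qed
  next
    assume "(G t)\<^sup>2 \<le> 4 * L * (h t - h (Suc t))"
    moreover have "M\<^sup>2 \<le> (G t)\<^sup>2" using Mt M(1) by (rule power_mono)
    ultimately show ?thesis by simp
  qed
qed

section \<open>Sublinear rates for \<open>h\<close> and for the gap\<close>

lemma h_antimono: "gen t \<Longrightarrow> 1 \<le> s \<Longrightarrow> s \<le> t \<Longrightarrow> h t \<le> h s"
proof (induction t)
  case (Suc t)
  show ?case
  proof (cases "s = Suc t")
    case False
    then have t: "t \<ge> 1" "s \<le> t" using Suc.prems by auto
    then show ?thesis
      using Suc.IH gen_t[OF t(1) Suc.prems(1)] Suc.prems h_decreasing[OF t(1) Suc.prems(1)] by auto
  qed simp
qed simp

text \<open>\<open>x 1\<close> minimises the linearisation of \<open>f\<close> at \<open>x0\<close>,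
  whose minimum over \<open>P\<close> is at most the optimal value by convexity. What remains is the
  quadratic term of the descent lemma.\<close>

lemma h1_le: "h 1 \<le> L / 2"
proof -
  obtain z where z: "z \<in> P" "f z = opt_val f P" using opt_val_attained by blast
  have x1P: "x 1 \<in> P" using x1_vertex vertices_subset by auto
  have "x 1 \<bullet> grad x0 \<le> z \<bullet> grad x0"
    using x1 by (intro inner_ge_vertices[OF z(1)]) (auto simp: is_arg_min_linorder)
  moreover have "f (x 1) \<le> f x0 + (x 1 - x0) \<bullet> grad x0 + \<beta> / 2 * (norm (x 1 - x0))\<^sup>2"
    using smooth_upper_bound[OF gderiv_f lipschitz_grad, of x0 "x 1 - x0"] by simp
  moreover have "f x0 + (z - x0) \<bullet> grad x0 \<le> f z"
    using convex_lower_bound[OF convex_f gderiv_f, of x0 "z - x0"] by simp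
  moreover have "\<beta> / 2 * (norm (x 1 - x0))\<^sup>2 \<le> \<beta> / 2 * (diameter P)\<^sup>2"
    using lipschitz_on_nonneg[OF lipschitz_grad] norm_diff_le_diameter[OF x1P x0]
    by (intro mult_left_mono power_mono) auto
  ultimately show ?thesis
    using z(2) by (simp add: h_def L_def inner_diff_left)
qed

text \<open>\<open>M = h t\<close> is admissible in \<open>progress\<close>, since \<open>h\<close>
  decreases and is at most \<open>G\<close>. This gives
  \<open>h (Suc t) \<le> h t - (h t)\<^sup>2 / (4 * L)\<close>. The offset 7 makes the base case
  \<open>t = 1\<close> coincide with \<open>h1_le\<close>.\<close>

lemma sublinear_rate:
  assumes "gen t"
  shows "h t * (real t + 7) \<le> 4 * L"
proof -
  have "1 \<le> t" using assms by (simp add: generated_def)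
  then show ?thesis using assms
  proof (induction t rule: dec_induct)
    case base
    then show ?case using h1_le by simp
  next
    case (step t)
    note s = step.hyps(1) step.prems
    define \<delta> where "\<delta> = h t - h (Suc t)"
    have IH: "h t * (real t + 7) \<le> 4 * L" using step.IH gen_t[OF s] by simp
    have h0: "0 \<le> h t" using h_nonneg gen_t[OF s] by simp
    have \<delta>: "\<delta> > 0" using h_decreasing[OF s] by (simp add: \<delta>_def)
    then have hpos: "h t > 0" using h_nonneg[OF step.prems] by (simp add: \<delta>_def)
    \<comment> \<open>The invariant yields \<open>2 * h t \<le> L\<close>, by which the linear
      alternative of \<open>progress\<close> implies the quadratic one.\<close>
    have "h t * 8 \<le> h t * (real t + 7)"
      using s(1) h0 by (intro mult_left_mono) auto
    then have half: "2 * h t \<le> L" using IH by simp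
    then have L: "L > 0" using hpos by simp
    have "h t \<le> G \<tau>" if "\<tau> \<in> {1..t}" for \<tau>
    proof -
      have "gen (Suc \<tau>)" using gen_antimono[OF step.prems, of "Suc \<tau>"] that by simp
      then show ?thesis
        using h_le_G[of \<tau>] h_antimono[OF gen_t[OF s], of \<tau>] that by force
    qed
    from progress[OF s h0 this] have dec: "(h t)\<^sup>2 \<le> 4 * L * \<delta>"
    proof
      assume "h t \<le> 4 * (h t - h (Suc t))"
      then have "h t * (2 * h t) \<le> (4 * \<delta>) * L"
        using half h0 \<delta> by (intro mult_mono) (auto simp: \<delta>_def)
      then show ?thesis
        using mult_pos_pos[OF \<delta> L] by (simp add: power2_eq_square algebra_simps)
    next
      assume "(h t)\<^sup>2 \<le> 4 * L * (h t - h (Suc t))"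
      then show ?thesis unfolding \<delta>_def .
    qed
    \<comment> \<open>Normalised, the recursion becomes \<open>u - u\<^sup>2\<close>, and the claim
      reduces to \<open>(1 + u) * (1 - u) \<le> 1\<close>.\<close>
    define u where "u = h t / (4 * L)"
    have u: "0 \<le> u" "u \<le> 1" "u * (real t + 7) \<le> 1"
      using IH half h0 L by (auto simp: u_def field_simps)
    have "u\<^sup>2 * (4 * L) \<le> \<delta>"
      using dec L by (simp add: u_def field_simps power2_eq_square)
    then have "h (Suc t) \<le> 4 * L * (u - u\<^sup>2)"
      using L by (simp add: \<delta>_def u_def right_diff_distrib algebra_simps)
    then have "h (Suc t) * (real (Suc t) + 7) \<le> (4 * L * (u - u\<^sup>2)) * (real (Suc t) + 7)"
      by (rule mult_right_mono) simp
    also have "\<dots> = 4 * L * ((u * (real t + 7) + u) * (1 - u))"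
      by (simp add: power2_eq_square algebra_simps)
    also have "\<dots> \<le> 4 * L * ((1 + u) * (1 - u))"
      using u L by (intro mult_left_mono mult_right_mono) auto
    also have "(1 + u) * (1 - u) \<le> 1"
      by (simp add: algebra_simps)
    then have "4 * L * ((1 + u) * (1 - u)) \<le> 4 * L"
      using L by simp
    finally show ?case .
  qed
qed

text \<open>Each iteration gains at least a fixed \<open>c\<close>, so
  \<open>(t - s) * c \<le> h s\<close> for every start \<open>s\<close>. If
  \<open>L \<le> M\<close>, then \<open>c = M / 4\<close> and \<open>s = 1\<close> suffices;
  otherwise \<open>s\<close> is taken halfway, where \<open>sublinear_rate\<close> makes
  \<open>h s\<close> small.\<close>

lemma gap_rate:
  assumes gen: "gen t" and "t \<ge> 2" and M: "\<And>\<tau>. \<tau> \<in> {1..t} \<Longrightarrow> M \<le> gap \<tau>"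
  shows "M * (real t - 1) \<le> 8 * L"
proof (cases "M > 0")
  case False
  then have "M * (real t - 1) \<le> 0" using \<open>t \<ge> 2\<close> by (simp add: mult_le_0_iff)
  then show ?thesis using L_nonneg by simp
next
  case True
  have step: "M \<le> 4 * (h s - h (Suc s)) \<or> M\<^sup>2 \<le> 4 * L * (h s - h (Suc s))"
    if "s \<in> {1..<t}" for s
  proof -
    have "gen (Suc s)" using gen_antimono[OF gen, of "Suc s"] that by simp
    moreover have "M \<le> G \<tau>" if \<tau>: "\<tau> \<in> {1..s}" for \<tau>
    proof -
      have "gen (Suc \<tau>)" using gen_antimono[OF gen, of "Suc \<tau>"] \<tau> \<open>s \<in> {1..<t}\<close> by simp
      then show ?thesis using gap_le_G[of \<tau>] M[of \<tau>] \<tau> \<open>s \<in> {1..<t}\<close> by force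
    qed
    ultimately show ?thesis using progress[of s M] that True by simp
  qed
  have "gen (Suc 1)" using gen_antimono[OF gen, of 2] \<open>t \<ge> 2\<close> by (simp add: numeral_2_eq_2)
  from h_decreasing[OF _ this] h_nonneg[OF this] have L: "L > 0"
    using h1_le by simp
  define c where "c = min (M / 4) (M\<^sup>2 / (4 * L))"
  have dec: "c \<le> h s - h (Suc s)" if "s \<in> {1..<t}" for s
  proof -
    have "M / 4 \<le> h s - h (Suc s) \<or> M\<^sup>2 / (4 * L) \<le> h s - h (Suc s)"
      using step[OF that] L by (auto simp: pos_divide_le_eq mult.commute)
    then show ?thesis by (simp add: c_def min_le_iff_disj)
  qed
  have total: "real (t - s) * c \<le> h s" if s: "s \<in> {1..t}" for s
  proof -
    have "real (t - s) * c = (\<Sum>r\<in>{s..<t}. c)" by simp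
    also have "\<dots> \<le> (\<Sum>r\<in>{s..<t}. h r - h (Suc r))"
      using dec s by (intro sum_mono) auto
    also have "\<dots> = h s - h t"
      using sum_Suc_diff'[of s t "\<lambda>r. - h r"] s by simp
    finally show ?thesis using h_nonneg[OF gen] by simp
  qed
  define n where "n = t - 1"
  have n: "real t - 1 = real n" "t = Suc n" using \<open>t \<ge> 2\<close> by (auto simp: n_def)
  show ?thesis
  proof (cases "L \<le> M")
    case True
    then have "c = M / 4"
      using L by (simp add: c_def min_def field_simps power2_eq_square)
    then have "M * real n = 4 * (real n * c)" by simp
    moreover have "real n * c \<le> h 1" using total[of 1] n(2) by simp
    ultimately show ?thesis using h1_le L unfolding n(1) by linarith
  next
    case False
    then have c: "c = M\<^sup>2 / (4 * L)"
      using L \<open>M > 0\<close> by (simp add: c_def min_def field_simps power2_eq_square)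
    define m where "m = n div 2"
    have m: "n = 2 * m \<or> n = Suc (2 * m)" by (auto simp: m_def)
    have nm: "real (t - Suc m) = real n - real m" using m n(2) by auto
    have "gen (Suc m)" using gen_antimono[OF gen, of "Suc m"] m n(2) by auto
    then have "h (Suc m) * (real m + 8) \<le> 4 * L"
      using sublinear_rate[of "Suc m"] by (simp add: algebra_simps)
    moreover have "(real n - real m) * c * (real m + 8) \<le> h (Suc m) * (real m + 8)"
      using total[of "Suc m"] m n(2) nm by (intro mult_right_mono) auto
    ultimately have "(real n - real m) * c * (real m + 8) \<le> 4 * L"
      by (rule order_trans[rotated])
    then have bound: "((real n - real m) * (real m + 8)) * M\<^sup>2 \<le> 16 * L\<^sup>2"
      unfolding c using L by (simp add: field_simps power2_eq_square)
    \<comment> \<open>Both \<open>n - m\<close> and \<open>m + 8\<close> are at least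
      \<open>n / 2\<close>; the factor 4 lost here turns 16 into \<open>8\<^sup>2\<close>.\<close>
    have "(real n)\<^sup>2 \<le> 4 * ((real n - real m) * (real m + 8))"
      using m by (auto simp: power2_eq_square algebra_simps)
    then have "(real n)\<^sup>2 * M\<^sup>2 \<le> 4 * ((real n - real m) * (real m + 8)) * M\<^sup>2"
      by (rule mult_right_mono) simp
    then have "(M * real n)\<^sup>2 \<le> (8 * L)\<^sup>2"
      using bound by (simp add: power_mult_distrib algebra_simps)
    from power2_le_imp_le[OF this] show ?thesis using L by (simp add: n(1))
  qed
qed

section \<open>Linear rate under quadratic growth\<close>

lemma aff_dim_opt_face_nonneg: "aff_dim (opt_face f P) \<ge> 0"
proof -
  obtain z where "z \<in> opt_set f P" using infdist_opt_set_attained by blast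
  then have "opt_face f P \<noteq> {}" by (auto simp: opt_face_def)
  then have "aff_dim (opt_face f P) \<noteq> -1" by (simp add: aff_dim_empty)
  then show ?thesis using aff_dim_geq[of "opt_face f P"] by linarith
qed

lemma opt_face_face: "opt_face f P face_of P"
proof -
  have "P \<in> {F. F face_of P \<and> opt_set f P \<subseteq> F}"
    using face_of_refl[OF convex_P] by (auto simp: opt_set_eq)
  then show ?thesis
    unfolding opt_face_def by (intro face_of_Inter) auto
qed

text \<open>The decomposition gives \<open>h t \<le> \<Delta> * G t\<close>, and quadratic growth
  bounds \<open>\<Delta>\<^sup>2\<close> by a multiple of \<open>h t\<close>. After squaring, one
  factor \<open>h t\<close> cancels; it is positive because iteration \<open>t\<close> strictly
  decreases \<open>h\<close>.\<close>

lemma G_lower_quadratic_growth: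
  assumes qg: "quadratic_growth f P \<alpha>" and \<alpha>: "\<alpha> > 0"
    and t: "t \<ge> 1" and step: "gen (Suc t)"
  shows "\<alpha> * h t \<le> 2 * (real_of_int (aff_dim (opt_face f P)) + 1) * (G t)\<^sup>2"
proof -
  let ?F = "opt_face f P"
  define K where "K = real_of_int (aff_dim ?F) + 1"
  have g: "gen t" using gen_t[OF t step] .
  obtain z where z: "z \<in> opt_set f P" "infdist (x t) (opt_set f P) = norm (x t - z)"
    by (rule infdist_opt_set_attained)
  have "z \<in> ?F" using z(1) by (auto simp: opt_face_def)
  then have "z \<in> convex hull (vertices P \<inter> ?F)"
    using face_eq_hull_vertices[OF opt_face_face] by simp
  \<comment> \<open>Applying Caratheodory inside the optimal face brings in the dimension of that
    face instead of that of \<open>P\<close>.\<close>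
  from subsetD[OF equalityD1[OF caratheodory_aff_dim] this] obtain S
    where S: "finite S" "S \<subseteq> vertices P \<inter> ?F"
      "int (card S) \<le> aff_dim (vertices P \<inter> ?F) + 1" "z \<in> convex hull S"
    by blast
  have "int (card S) \<le> aff_dim ?F + 1"
    using S(3) aff_dim_subset[of "vertices P \<inter> ?F" ?F] by auto
  then have card: "real (card S) \<le> K" unfolding K_def by linarith
  obtain \<Delta> where \<Delta>: "\<Delta> \<ge> 0" "\<Delta>\<^sup>2 \<le> card S * (norm (x t - z))\<^sup>2"
      "(x t - z) \<bullet> grad (x t) \<le> \<Delta> * (vm t \<bullet> grad (x t) - vp t \<bullet> grad (x t))"
  proof (rule decomposition_invariant_bound[of A b I "x t" S z])
    show "bounded (std_polyhedron A b I)" "x t \<in> std_polyhedron A b I"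
      using bounded_P x_in_P[OF g] by (auto simp: P_eq)
    show "S \<subseteq> std_polyhedron A b I" "\<forall>v\<in>S. \<forall>i\<in>I. v $ i \<in> {0, 1}"
      using S(2) vertices_subset vertices_01 by (auto simp: P_eq)
    show "p \<bullet> grad (x t) \<le> vm t \<bullet> grad (x t)" if "p \<in> min_face (std_polyhedron A b I) I (x t)" for p
      using vm_max[OF t step] that by (simp add: P_eq)
    show "vp t \<bullet> grad (x t) \<le> q \<bullet> grad (x t)" if "q \<in> std_polyhedron A b I" for q
      using vp_min[OF g] that by (simp add: P_eq)
  qed (use S in auto)
  have h0: "0 \<le> h t" using h_nonneg[OF g] .
  have "h t \<le> (x t - z) \<bullet> grad (x t)"
  proof -
    have "f z \<le> opt_val f P" using z(1) by (simp add: opt_set_eq)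
    then show ?thesis
      using convex_lower_bound[OF convex_f gderiv_f, of "x t" "z - x t"]
      by (simp add: h_def inner_diff_left)
  qed
  also have "\<dots> \<le> \<Delta> * G t"
    using \<Delta>(3) by (simp add: G_def d_def inner_diff_left)
  finally have "(h t)\<^sup>2 \<le> (\<Delta> * G t)\<^sup>2" using h0 by (rule power_mono)
  also have "\<dots> = \<Delta>\<^sup>2 * (G t)\<^sup>2" by (rule power_mult_distrib)
  also have "\<dots> \<le> (K * (2 / \<alpha> * h t)) * (G t)\<^sup>2"
  proof (rule mult_right_mono)
    have "(norm (x t - z))\<^sup>2 \<le> 2 / \<alpha> * h t"
      using qg x_in_P[OF g] z(2) by (auto simp: quadratic_growth_def h_def)
    then have "card S * (norm (x t - z))\<^sup>2 \<le> K * (2 / \<alpha> * h t)"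
      using card by (intro mult_mono) auto
    then show "\<Delta>\<^sup>2 \<le> K * (2 / \<alpha> * h t)" using \<Delta>(2) by simp
  qed simp
  finally have "h t * (\<alpha> * h t) \<le> h t * (2 * K * (G t)\<^sup>2)"
    using \<alpha> by (simp add: field_simps power2_eq_square)
  moreover have "0 < h t"
    using h_decreasing[OF t step] h_nonneg[OF step] by simp
  ultimately show ?thesis by (simp add: K_def)
qed

text \<open>The two terms of \<open>M\<close> serve the two alternatives of \<open>progress\<close>.
  For \<open>L > 0\<close> they yield \<open>h t \<le> 4 * \<delta>\<close> and
  \<open>\<alpha> * h t / (K * L) \<le> 8 * \<delta>\<close> respectively, both within the constant
  16.\<close>

lemma linear_rate:
  assumes qg: "quadratic_growth f P \<alpha>" and \<alpha>: "\<alpha> > 0"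
    and t: "t \<ge> 1" and step: "gen (Suc t)"
  shows "h (Suc t) \<le> (1 - 1 / 16 * min 1 (\<alpha> / ((real_of_int (aff_dim (opt_face f P)) + 1) * L))) * h t"
proof -
  define K where "K = real_of_int (aff_dim (opt_face f P)) + 1"
  define \<delta> where "\<delta> = h t - h (Suc t)"
  define M where "M = max (h t) (sqrt (\<alpha> * h t / (2 * K)))"
  have K: "K \<ge> 1" using aff_dim_opt_face_nonneg by (simp add: K_def)
  have h0: "0 \<le> h t" using h_nonneg[OF gen_t[OF t step]] .
  have \<delta>: "0 < \<delta>" using h_decreasing[OF t step] by (simp add: \<delta>_def)
  have MG: "M \<le> G \<tau>" if \<tau>: "\<tau> \<in> {1..t}" for \<tau>
  proof -
    have s: "\<tau> \<ge> 1" "gen (Suc \<tau>)" using gen_antimono[OF step, of "Suc \<tau>"] \<tau> by auto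
    \<comment> \<open>\<open>M\<close> is built from the smallest value of \<open>h\<close> so far,
      so it bounds the earlier gaps as well.\<close>
    have h: "h t \<le> h \<tau>" using h_antimono[OF gen_t[OF t step], of \<tau>] \<tau> by simp
    have "\<alpha> * h t / (2 * K) \<le> \<alpha> * h \<tau> / (2 * K)"
      using h \<alpha> K by (simp add: divide_right_mono)
    also have "\<dots> \<le> (G \<tau>)\<^sup>2"
      using G_lower_quadratic_growth[OF qg \<alpha> s] K by (simp add: K_def field_simps)
    finally have "sqrt (\<alpha> * h t / (2 * K)) \<le> G \<tau>"
      using G_nonneg[OF s] by (rule real_le_lsqrt[rotated])
    then show ?thesis using h h_le_G[OF s] by (simp add: M_def)
  qed
  have M0: "0 \<le> M" using h0 by (simp add: M_def)
  have "1 / 16 * min 1 (\<alpha> / (K * L)) * h t \<le> \<delta>"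
    using progress[OF t step M0 MG]
  proof
    assume "M \<le> 4 * (h t - h (Suc t))"
    then have "h t \<le> 16 * \<delta>" using \<delta> by (auto simp: M_def \<delta>_def)
    moreover have "min 1 (\<alpha> / (K * L)) * h t \<le> 1 * h t"
      using h0 by (intro mult_right_mono) auto
    ultimately show ?thesis by simp
  next
    assume M: "M\<^sup>2 \<le> 4 * L * (h t - h (Suc t))"
    have "(sqrt (\<alpha> * h t / (2 * K)))\<^sup>2 \<le> M\<^sup>2"
      using h0 \<alpha> K by (intro power_mono) (auto simp: M_def)
    then have *: "\<alpha> * h t / (2 * K) \<le> 4 * L * \<delta>"
      using M h0 \<alpha> K by (simp add: \<delta>_def)
    show ?thesis
    \<comment> \<open>For \<open>L = 0\<close> the quotient is 0 by the convention on division, and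
      the claim only says that \<open>h\<close> does not increase.\<close>
    proof (cases "L = 0")
      case True
      then show ?thesis using \<delta> by simp
    next
      case False
      then have L: "L > 0" using L_nonneg by simp
      have "min 1 (\<alpha> / (K * L)) * h t \<le> \<alpha> / (K * L) * h t"
        using h0 by (intro mult_right_mono) auto
      also have "\<dots> \<le> 8 * \<delta>"
        using * K L by (simp add: field_simps)
      finally show ?thesis using \<delta> by simp
    qed
  qed
  then show ?thesis by (simp add: \<delta>_def K_def algebra_simps)
qed

end

theorem theorem1:
  fixes A :: "real^'n^'m" and b :: "real^'m" and I :: "'n set"
    and P :: "(real^'n) set"
    and f :: "real^'n \<Rightarrow> real" and grad :: "real^'n \<Rightarrow> real^'n" and \<beta> :: real
    and x0 :: "real^'n" and x vp vm :: "nat \<Rightarrow> real^'n" and \<eta> :: "nat \<Rightarrow> real"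
  defines "P \<equiv> std_polyhedron A b I"
  assumes "bounded P"
    and "vertices P \<noteq> {}"
    and "two_level P I"
    and "\<forall>v\<in>vertices P. \<forall>i\<in>I. v $ i \<in> {0, 1}"
    and "convex_on UNIV f"
    and "\<forall>y. GDERIV f y :> grad y"
    and "continuous_on UNIV grad"
    and "\<beta>-lipschitz_on UNIV grad"
    and "pdicg_run f grad P I x vp vm \<eta>"
    and "x0 \<in> P"
    and "is_arg_min (\<lambda>v. v \<bullet> grad x0) (\<lambda>v. v \<in> vertices P) (x 1)"
  shows
    "(\<forall>\<alpha>>0. quadratic_growth f P \<alpha> \<longrightarrow>
        (\<forall>t\<ge>1. generated grad x vp (t + 1) \<longrightarrow>
           f (x (t + 1)) - opt_val f P
           \<le> (1 - 1 / 16 * min 1 (\<alpha> / ((real_of_int (aff_dim (opt_face f P)) + 1) * \<beta> * (diameter P)\<^sup>2)))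
              * (f (x t) - opt_val f P))) \<and>
     (\<forall>t\<ge>1. generated grad x vp t \<longrightarrow>
        f (x t) - opt_val f P \<le> 8 * \<beta> * (diameter P)\<^sup>2 / (real t + 15)) \<and>
     (\<forall>t\<ge>3. generated grad x vp t \<longrightarrow>
        Min (fw_gap grad x vp ` {1..t})
        \<le> 16 * \<beta> * (diameter P)\<^sup>2 / (real t - 1) * ln (real t - 1))"
proof -
  interpret pdicg A b I P f grad \<beta> x0 x vp vm \<eta>
  proof unfold_locales
    show "P = std_polyhedron A b I" by (simp add: P_def)
    show "GDERIV f y :> grad y" for y using assms(7) by blast
  qed (fact assms)+
  show ?thesis
  proof (intro conjI allI impI)
    fix \<alpha> :: real and t :: nat
    assume "\<alpha> > 0" "quadratic_growth f P \<alpha>" "1 \<le> t" "generated grad x vp (t + 1)"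
    then show "f (x (t + 1)) - opt_val f P
        \<le> (1 - 1 / 16 * min 1 (\<alpha> / ((real_of_int (aff_dim (opt_face f P)) + 1) * \<beta> * (diameter P)\<^sup>2)))
           * (f (x t) - opt_val f P)"
      using linear_rate[of \<alpha> t] by (simp add: h_def L_def mult.assoc)
  next
    fix t :: nat
    assume t: "1 \<le> t" "generated grad x vp t"
    have "h t \<le> 4 * L / (real t + 7)"
      using sublinear_rate[OF t(2)] by (simp add: pos_le_divide_eq)
    \<comment> \<open>After doubling, \<open>2 * t + 14 \<ge> t + 15\<close> holds exactly from
      \<open>t = 1\<close> on.\<close>
    also have "\<dots> = 8 * L / (2 * real t + 14)"
      by (simp add: field_simps)
    also have "\<dots> \<le> 8 * L / (real t + 15)"
      using t(1) L_nonneg by (intro divide_left_mono) auto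
    finally show "f (x t) - opt_val f P \<le> 8 * \<beta> * (diameter P)\<^sup>2 / (real t + 15)"
      by (simp add: h_def L_def)
  next
    fix t :: nat
    assume t: "3 \<le> t" "generated grad x vp t"
    let ?M = "Min (fw_gap grad x vp ` {1..t})"
    have "?M * (real t - 1) \<le> 8 * L"
      using t by (intro gap_rate) auto
    \<comment> \<open>The 8 is written as \<open>16 * (1 / 2)\<close>; \<open>t \<ge> 3\<close>
      gives \<open>ln (t - 1) \<ge> ln 2 \<ge> 1 / 2\<close>.\<close>
    then have "?M \<le> 16 * L / (real t - 1) * (1 / 2)"
      using t(1) by (simp add: field_simps)
    also have "\<dots> \<le> 16 * L / (real t - 1) * ln (real t - 1)"
    proof (rule mult_left_mono)
      have "1 / 2 \<le> ln (2::real)" using ln2_ge_two_thirds by simp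
      also have "\<dots> \<le> ln (real t - 1)" using t(1) by simp
      finally show "1 / 2 \<le> ln (real t - 1)" .
    qed (use t(1) L_nonneg in auto)
    finally show "?M \<le> 16 * \<beta> * (diameter P)\<^sup>2 / (real t - 1) * ln (real t - 1)"
      by (simp add: L_def mult.assoc)
  qed
qed

end
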